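(* Let $S\subset\mathbb{R}^n$ be a set of positive Lebesgue measure and let $P,Q$ be two matrix-valued polynomials on $\mathbb{R}^n$. Suppose that there exists $s$ such that $\operatorname{rank}P(\xi)+\operatorname{rank}Q(\xi)=s$ for all $\xi\in S$. Then both $P$ and $Q$ have constant rank on $S$, i.e. $\xi\mapsto\operatorname{rank}P(\xi)$ and $\xi\mapsto\operatorname{rank}Q(\xi)$ are constant on $S$.
   Context: A matrix-valued polynomial on $\mathbb{R}^n$ is a map $\mathbb{R}^n\to\mathbb{R}^{N\times m}$ each of whose entries is a polynomial in $\xi\in\mathbb{R}^n$. *)

theory Defs
  imports "HOL-Analysis.Analysis"
begin

text \<open>A real polynomial function on R^n (n = CARD('n)): a finite linear combination
  of monomials x_1^a_1 ... x_n^a_n, with multi-indices a :: 'n => nat.\<close>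
definition poly_fun :: "(real^'n \<Rightarrow> real) \<Rightarrow> bool" where
  "poly_fun f \<longleftrightarrow> (\<exists>E c. finite E \<and>
     (\<forall>x. f x = (\<Sum>\<alpha>\<in>E. c \<alpha> * (\<Prod>i\<in>UNIV. (x $ i) ^ (\<alpha> i)))))"

text \<open>A matrix-valued polynomial R^n -> R^(N x m): every entry is a polynomial.\<close>
definition matrix_poly :: "(real^'n \<Rightarrow> real^'m^'k) \<Rightarrow> bool" where
  "matrix_poly P \<longleftrightarrow> (\<forall>i j. poly_fun (\<lambda>x. P x $ i $ j))"

end

theory Submission
  imports Defs
begin

(* A polynomial that is not identically zero vanishes only on a null set: by induction on the
   degree, off the zero set of a nonvanishing partial derivative the zero set is mapped into a
   hyperplane by a map with injective derivative.
   If the rank of P is maximal, say R, at x0, and C = sum of b b^T over a basis b of ker P(x0),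
   then det (P^T P + C) is a polynomial that is nonzero at x0 and vanishes wherever rank P < R.
   So P and Q attain their maximal ranks RP and RQ almost everywhere; since S has positive measure,
   some point of S has both, whence s = RP + RQ, and rank P <= RP, rank Q <= RQ force equality on
   all of S. *)

inductive poly_deg_le :: "nat \<Rightarrow> ('a::real_normed_vector \<Rightarrow> real) \<Rightarrow> bool" where
  const: "poly_deg_le d (\<lambda>x. c)"
| linear: "bounded_linear f \<Longrightarrow> poly_deg_le (Suc d) f"
| add: "poly_deg_le d f \<Longrightarrow> poly_deg_le d g \<Longrightarrow> poly_deg_le d (\<lambda>x. f x + g x)"
| mult: "poly_deg_le d f \<Longrightarrow> poly_deg_le e g \<Longrightarrow> poly_deg_le (d + e) (\<lambda>x. f x * g x)"

lemma poly_deg_le_mono: "poly_deg_le d f \<Longrightarrow> d \<le> e \<Longrightarrow> poly_deg_le e f"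
proof (induction arbitrary: e rule: poly_deg_le.induct)
  case (linear f d)
  then show ?case by (metis Suc_le_D poly_deg_le.linear)
next
  case (mult d f e' g)
  then have "poly_deg_le (d + (e - d)) (\<lambda>x. f x * g x)"
    by (intro poly_deg_le.mult) simp_all
  with mult.prems show ?case by simp
qed (auto intro: poly_deg_le.intros)

lemma real_polynomial_function_imp_poly_deg_le:
  "real_polynomial_function f \<Longrightarrow> \<exists>d. poly_deg_le d f"
proof (induction rule: real_polynomial_function.induct)
  case (add f g)
  then obtain d e where "poly_deg_le d f" "poly_deg_le e g" by blast
  then have "poly_deg_le (max d e) f" "poly_deg_le (max d e) g"
    by (auto intro: poly_deg_le_mono)
  then show ?case by (blast intro: poly_deg_le.add)
qed (blast intro: poly_deg_le.intros)+

lemma poly_deg_le_0_imp_const: "poly_deg_le 0 f \<Longrightarrow> \<exists>c. f = (\<lambda>x. c)"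
  by (induction "0::nat" f rule: poly_deg_le.induct) force+

text \<open>Since \<open>d - 1\<close> truncates to \<open>0\<close>, the product rule needs the last conjunct: a factor of
  degree \<open>0\<close> contributes no derivative term.\<close>

lemma poly_deg_le_has_derivative:
  "poly_deg_le d f \<Longrightarrow> \<exists>f'. (\<forall>x. (f has_derivative f' x) (at x))
     \<and> (\<forall>v. poly_deg_le (d - 1) (\<lambda>x. f' x v)) \<and> (d = 0 \<longrightarrow> (\<forall>x v. f' x v = 0))"
proof (induction rule: poly_deg_le.induct)
  case (const d c)
  show ?case
    by (rule exI[of _ "\<lambda>x v. 0"]) (auto intro: poly_deg_le.const)
next
  case (linear f d)
  then show ?case
    by (intro exI[of _ "\<lambda>x. f"]) (auto intro: poly_deg_le.const bounded_linear_imp_has_derivative)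
next
  case (add d f g)
  then obtain f' g' where f': "\<forall>x. (f has_derivative f' x) (at x)"
      "\<forall>v. poly_deg_le (d - 1) (\<lambda>x. f' x v)" "d = 0 \<longrightarrow> (\<forall>x v. f' x v = 0)"
    and g': "\<forall>x. (g has_derivative g' x) (at x)"
      "\<forall>v. poly_deg_le (d - 1) (\<lambda>x. g' x v)" "d = 0 \<longrightarrow> (\<forall>x v. g' x v = 0)"
    by blast
  show ?case
    using f' g'
    by (intro exI[of _ "\<lambda>x v. f' x v + g' x v"]) (auto intro: has_derivative_add poly_deg_le.add)
next
  case (mult d f e g)
  then obtain f' g' where f': "\<forall>x. (f has_derivative f' x) (at x)"
      "\<forall>v. poly_deg_le (d - 1) (\<lambda>x. f' x v)" "d = 0 \<longrightarrow> (\<forall>x v. f' x v = 0)"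
    and g': "\<forall>x. (g has_derivative g' x) (at x)"
      "\<forall>v. poly_deg_le (e - 1) (\<lambda>x. g' x v)" "e = 0 \<longrightarrow> (\<forall>x v. g' x v = 0)"
    by blast
  define fg' where "fg' x v = f x * g' x v + f' x v * g x" for x v
  have "((\<lambda>x. f x * g x) has_derivative fg' x) (at x)" for x
    unfolding fg'_def using f'(1) g'(1) by (auto intro: has_derivative_mult)
  moreover have "poly_deg_le (d + e - 1) (\<lambda>x. fg' x v)" for v
  proof -
    have left: "poly_deg_le (d + e - 1) (\<lambda>x. f' x v * g x)" if "d \<noteq> 0"
      using poly_deg_le.mult[OF f'(2)[rule_format, of v] mult.hyps(2)] that
      by (simp add: add.commute)
    have right: "poly_deg_le (d + e - 1) (\<lambda>x. f x * g' x v)" if "e \<noteq> 0"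
      using poly_deg_le.mult[OF mult.hyps(1) g'(2)[rule_format, of v]] that by simp
    show ?thesis
      using f'(3) g'(3) left right
      by (cases "d = 0"; cases "e = 0")
         (auto simp: fg'_def intro: poly_deg_le.const poly_deg_le.add)
  qed
  moreover have "fg' x v = 0" if "d + e = 0" for x v
    using that f'(3) g'(3) by (simp add: fg'_def)
  ultimately show ?case by blast
qed

lemma negligible_zeros_with_nonzero_derivative:
  fixes f :: "'a::euclidean_space \<Rightarrow> real"
  assumes f': "\<And>x. (f has_derivative f' x) (at x)" and b: "norm b = 1"
  shows "negligible {x. f' x b \<noteq> 0 \<and> f x = 0}"
proof -
  \<comment> \<open>\<open>\<Phi> x \<bullet> b = f x\<close>, so \<open>\<Phi>\<close> maps the set into the hyperplane \<open>b\<^sup>\<bottom>\<close>.\<close>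
  define \<Phi> where "\<Phi> x = x + (f x - x \<bullet> b) *\<^sub>R b" for x
  define \<Phi>' where "\<Phi>' x h = h + (f' x h - h \<bullet> b) *\<^sub>R b" for x h
  have bb: "b \<bullet> b = 1"
    using b by (simp add: norm_eq_1)
  have \<Phi>': "(\<Phi> has_derivative \<Phi>' x) (at x within S)" for x S
  proof -
    have "((\<lambda>x. f x - x \<bullet> b) has_derivative (\<lambda>h. f' x h - h \<bullet> b)) (at x within S)"
      by (intro has_derivative_diff has_derivative_at_withinI[OF f']
          bounded_linear_imp_has_derivative bounded_linear_inner_left)
    then show ?thesis
      unfolding \<Phi>_def[abs_def] \<Phi>'_def
      by (intro has_derivative_add has_derivative_ident has_derivative_scaleR_left)
  qed
  moreover have "inj (\<Phi>' x)" if "f' x b \<noteq> 0" for x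
  proof -
    have lin: "linear (f' x)"
      using f' has_derivative_linear by blast
    have "h = 0" if h: "\<Phi>' x h = 0" for h
    proof -
      define t where "t = f' x h - h \<bullet> b"
      have "h + t *\<^sub>R b = 0"
        using h by (simp add: \<Phi>'_def t_def)
      then have h_eq: "h = - t *\<^sub>R b"
        by (simp add: eq_neg_iff_add_eq_0)
      have "t * f' x b = 0"
        using t_def[unfolded h_eq] bb by (simp add: linear_neg[OF lin] linear_cmul[OF lin] algebra_simps)
      with \<open>f' x b \<noteq> 0\<close> show "h = 0"
        by (simp add: h_eq)
    qed
    moreover have "linear (\<Phi>' x)"
      using \<Phi>' has_derivative_linear by blast
    ultimately show ?thesis
      using linear_injective_0 by blast
  qed
  ultimately have "negligible {x \<in> {x. f' x b \<noteq> 0}. \<Phi> x \<in> {y. b \<bullet> y = 0}}"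
    using b by (intro negligible_differentiable_vimage[where f' = \<Phi>'] negligible_hyperplane) auto
  moreover have "\<Phi> x \<bullet> b = f x" for x
    using bb by (simp add: \<Phi>_def algebra_simps)
  ultimately show ?thesis
    by (simp add: inner_commute)
qed

lemma poly_deg_le_negligible_zeros:
  fixes f :: "'a::euclidean_space \<Rightarrow> real"
  assumes "poly_deg_le d f" and "\<exists>x. f x \<noteq> 0"
  shows "negligible {x. f x = 0}"
  using assms
proof (induction d arbitrary: f)
  case 0
  then show ?case
    using poly_deg_le_0_imp_const by fastforce
next
  case (Suc d)
  obtain f' where f': "\<And>x. (f has_derivative f' x) (at x)"
    and deg: "\<And>v. poly_deg_le d (\<lambda>x. f' x v)"
    using poly_deg_le_has_derivative[OF Suc.prems(1)] by auto
  show ?case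
  proof (cases "\<forall>x v. f' x v = 0")
    case True
    then have "\<exists>c. \<forall>x\<in>UNIV. f x = c"
      using f' by (intro has_derivative_zero_constant) (auto simp: fun_eq_iff[symmetric])
    with Suc.prems(2) show ?thesis
      by auto
  next
    case False
    then obtain x0 v where "f' x0 v \<noteq> 0"
      by blast
    then have "v \<noteq> 0"
      using f' has_derivative_linear linear_0 by blast
    then have b: "norm (sgn v) = 1"
      by (simp add: norm_sgn)
    have lin: "linear (f' x)" for x
      using f' has_derivative_linear by blast
    have "f' x (sgn v) \<noteq> 0 \<longleftrightarrow> f' x v \<noteq> 0" for x
      using \<open>v \<noteq> 0\<close> by (simp add: sgn_div_norm linear_cmul[OF lin])
    then have "{x. f x = 0} \<subseteq> {x. f' x v = 0} \<union> {x. f' x (sgn v) \<noteq> 0 \<and> f x = 0}"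
      by blast
    moreover have "negligible {x. f' x v = 0}"
      using Suc.IH[OF deg] \<open>f' x0 v \<noteq> 0\<close> by blast
    moreover have "negligible {x. f' x (sgn v) \<noteq> 0 \<and> f x = 0}"
      using negligible_zeros_with_nonzero_derivative[OF f' b] .
    ultimately show ?thesis
      using negligible_Un negligible_subset by blast
  qed
qed

lemma real_polynomial_function_negligible_zeros:
  fixes f :: "'a::euclidean_space \<Rightarrow> real"
  assumes "real_polynomial_function f" and "\<exists>x. f x \<noteq> 0"
  shows "negligible {x. f x = 0}"
  using assms poly_deg_le_negligible_zeros real_polynomial_function_imp_poly_deg_le by blast

lemma poly_fun_imp_real_polynomial_function:
  assumes "poly_fun f"
  shows "real_polynomial_function f"
proof -
  obtain E c where "finite E" and "f = (\<lambda>x. \<Sum>\<alpha>\<in>E. c \<alpha> * (\<Prod>i\<in>UNIV. (x $ i) ^ (\<alpha> i)))"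
    using assms unfolding poly_fun_def fun_eq_iff by blast
  moreover have "real_polynomial_function (\<lambda>x::real^'n. x $ i)" for i
    by (intro real_polynomial_function.intros(1) bounded_linear_vec_nth)
  ultimately show ?thesis
    by (auto intro!: real_polynomial_function_sum real_polynomial_function_prod
        real_polynomial_function_power real_polynomial_function.intros(2,4))
qed

lemma real_polynomial_function_det:
  fixes M :: "'a::real_normed_vector \<Rightarrow> real^'n^'n"
  assumes "\<And>i j. real_polynomial_function (\<lambda>x. M x $ i $ j)"
  shows "real_polynomial_function (\<lambda>x. det (M x))"
  unfolding det_def using assms
  by (auto intro!: real_polynomial_function_sum real_polynomial_function_prod
      real_polynomial_function.intros(2,4))

lemma det_eq_0_iff_kernel:
  fixes M :: "real^'n^'n"
  shows "det M = 0 \<longleftrightarrow> (\<exists>v. v \<noteq> 0 \<and> M *v v = 0)"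
  using rank_bound[of M] by (auto simp: det_eq_0_rank matrix_nonfull_linear_equations_eq)

lemma dim_null_space_add_rank:
  fixes A :: "real^'m^'k"
  shows "dim {v. A *v v = 0} + rank A = CARD('m)"
proof -
  let ?R = "range ((*v) (transpose A))"
  have "dim {y \<in> UNIV. \<forall>x\<in>?R. orthogonal x y} + dim ?R = dim (UNIV :: (real^'m) set)"
    by (intro dim_subspace_orthogonal_to_vectors linear_subspace_image
        matrix_vector_mul_linear subspace_UNIV) simp
  moreover have "{y \<in> UNIV. \<forall>x\<in>?R. orthogonal x y} = {v. A *v v = 0}"
  proof -
    have "orthogonal (transpose A *v w) v \<longleftrightarrow> w \<bullet> (A *v v) = 0" for w v
      by (simp add: orthogonal_def transpose_matrix_vector dot_lmul_matrix)
    then show ?thesis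
      by (auto simp: transpose_matrix_vector) (metis inner_eq_zero_iff)
  qed
  moreover have "dim ?R = rank A"
    using rank_dim_range[of "transpose A"] rank_transpose[of A] by simp
  ultimately show ?thesis
    by simp
qed

definition outer_product_sum :: "(real^'n) set \<Rightarrow> real^'n^'n" where
  "outer_product_sum B = (\<chi> i j. \<Sum>b\<in>B. b $ i * b $ j)"

lemma outer_product_sum_mult:
  "outer_product_sum B *v v = (\<Sum>b\<in>B. (b \<bullet> v) *\<^sub>R b)"
proof -
  have "(\<Sum>j\<in>UNIV. (\<Sum>b\<in>B. b $ i * b $ j) * v $ j) = (\<Sum>b\<in>B. (b \<bullet> v) * b $ i)" for i
    unfolding inner_vec_def sum_distrib_right sum.swap[of _ UNIV B]
    by (intro sum.cong) (simp_all add: sum_distrib_right mult_ac)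
  then show ?thesis
    by (simp add: vec_eq_iff outer_product_sum_def matrix_vector_mult_def sum_component)
qed

lemma gram_plus_outer_product_sum_kernel:
  fixes A :: "real^'m^'k"
  assumes "finite B"
  shows "(transpose A ** A + outer_product_sum B) *v v = 0 \<longleftrightarrow> A *v v = 0 \<and> (\<forall>b\<in>B. b \<bullet> v = 0)"
proof -
  have G: "(transpose A ** A + outer_product_sum B) *v v
      = transpose A *v (A *v v) + (\<Sum>b\<in>B. (b \<bullet> v) *\<^sub>R b)"
    by (simp only: matrix_vector_mult_add_rdistrib matrix_vector_mul_assoc outer_product_sum_mult)
  have "v \<bullet> ((transpose A ** A + outer_product_sum B) *v v)
      = (A *v v) \<bullet> (A *v v) + (\<Sum>b\<in>B. (b \<bullet> v)\<^sup>2)"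
    unfolding G inner_add_right inner_sum_right
    by (simp add: transpose_matrix_vector inner_commute[of v] dot_lmul_matrix power2_eq_square)
  then have "(transpose A ** A + outer_product_sum B) *v v = 0 \<Longrightarrow> A *v v = 0 \<and> (\<forall>b\<in>B. b \<bullet> v = 0)"
    using assms by (simp add: add_nonneg_eq_0_iff sum_nonneg sum_nonneg_eq_0_iff)
  then show ?thesis
    by (auto simp: G)
qed

lemma kernel_meets_orthogonal_comp_kernel:
  fixes A :: "real^'m^'k" and A0 :: "real^'m^'l"
  assumes "rank A < rank A0"
  obtains v where "v \<noteq> 0" "A *v v = 0" "v \<in> {x. A0 *v x = 0}\<^sup>\<bottom>"
proof -
  define N where "N = {v. A *v v = 0}"
  define K where "K = {v. A0 *v v = 0}"
  have "subspace N" "subspace K"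
    unfolding N_def K_def by (rule linear_subspace_kernel[OF matrix_vector_mul_linear])+
  then have "dim {x + y |x y. x \<in> N \<and> y \<in> K\<^sup>\<bottom>} + dim (N \<inter> K\<^sup>\<bottom>) = dim N + dim (K\<^sup>\<bottom>)"
    by (intro dim_sums_Int subspace_orthogonal_comp)
  moreover have "dim {x + y |x y. x \<in> N \<and> y \<in> K\<^sup>\<bottom>} \<le> CARD('m)"
    by (rule dim_subset_UNIV_cart)
  moreover have "dim (K\<^sup>\<bottom>) + dim K = CARD('m)"
    using dim_subspace_orthogonal_to_vectors[OF \<open>subspace K\<close> subspace_UNIV]
    by (simp add: orthogonal_comp_def)
  moreover have "dim N + rank A = CARD('m)" "dim K + rank A0 = CARD('m)"
    unfolding N_def K_def by (rule dim_null_space_add_rank)+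
  ultimately have "dim (N \<inter> K\<^sup>\<bottom>) \<noteq> 0"
    using assms by linarith
  then show ?thesis
    using that by (auto simp: dim_eq_0 N_def K_def)
qed

lemma det_gram_detects_rank_drop:
  fixes A0 :: "real^'m^'k"
  obtains C :: "real^'m^'m" where "det (transpose A0 ** A0 + C) \<noteq> 0"
    and "\<And>A::real^'m^'k. rank A < rank A0 \<Longrightarrow> det (transpose A ** A + C) = 0"
proof -
  define K where "K = {v. A0 *v v = 0}"
  obtain B where B: "B \<subseteq> K" "independent B" "K \<subseteq> span B"
    by (meson basis_exists)
  then have "finite B"
    using finiteI_independent by blast
  note kernel = gram_plus_outer_product_sum_kernel[OF this]
  \<comment> \<open>The kernel of \<open>transpose A ** A + outer_product_sum B\<close> is the part of the kernel of \<open>A\<close>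
    orthogonal to \<open>K\<close>: trivial for \<open>A = A0\<close>, nontrivial when the rank of \<open>A\<close> drops.\<close>
  have "v = 0" if "A0 *v v = 0" and "\<forall>b\<in>B. b \<bullet> v = 0" for v
  proof -
    have "v \<in> span B"
      using that(1) B(3) by (auto simp: K_def)
    moreover have "\<And>b. b \<in> B \<Longrightarrow> orthogonal v b"
      using that(2) by (simp add: orthogonal_def inner_commute)
    ultimately have "orthogonal v v"
      by (rule orthogonal_to_span)
    then show "v = 0"
      by (simp add: orthogonal_def)
  qed
  then have "det (transpose A0 ** A0 + outer_product_sum B) \<noteq> 0"
    by (auto simp: det_eq_0_iff_kernel kernel)
  moreover have "det (transpose A ** A + outer_product_sum B) = 0"
    if less: "rank A < rank A0" for A :: "real^'m^'k"
  proof -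
    obtain v where "v \<noteq> 0" "A *v v = 0" "v \<in> K\<^sup>\<bottom>"
      using kernel_meets_orthogonal_comp_kernel[OF less] by (auto simp: K_def)
    moreover have "\<forall>b\<in>B. b \<bullet> v = 0"
      using \<open>v \<in> K\<^sup>\<bottom>\<close> B(1) by (auto simp: orthogonal_comp_def orthogonal_def)
    ultimately show ?thesis
      by (auto simp: det_eq_0_iff_kernel kernel)
  qed
  ultimately show ?thesis
    using that by blast
qed

lemma polynomial_matrix_generic_rank:
  fixes P :: "'a::euclidean_space \<Rightarrow> real^'m^'k"
  assumes poly: "\<And>i j. real_polynomial_function (\<lambda>x. P x $ i $ j)"
  obtains R where "\<And>x. rank (P x) \<le> R" and "negligible {x. rank (P x) < R}"
proof -
  define x0 where "x0 = arg_max (\<lambda>x. rank (P x)) (\<lambda>_. True)"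
  have "rank (P x) < Suc CARD('m)" for x
    using rank_bound[of "P x"] by simp
  then have max: "rank (P x) \<le> rank (P x0)" for x
    unfolding x0_def by (intro arg_max_nat_le) auto
  obtain C where C: "det (transpose (P x0) ** P x0 + C) \<noteq> 0"
    and drop: "\<And>A::real^'m^'k. rank A < rank (P x0) \<Longrightarrow> det (transpose A ** A + C) = 0"
    using det_gram_detects_rank_drop by blast
  have "real_polynomial_function (\<lambda>x. det (transpose (P x) ** P x + C))"
    using poly
    by (intro real_polynomial_function_det)
       (auto simp: matrix_matrix_mult_def transpose_def
         intro!: real_polynomial_function_sum real_polynomial_function.intros(2-4))
  then have "negligible {x. det (transpose (P x) ** P x + C) = 0}"
    using C by (intro real_polynomial_function_negligible_zeros) auto
  then have "negligible {x. rank (P x) < rank (P x0)}"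
    by (rule negligible_subset) (auto intro: drop)
  with max that show ?thesis
    by blast
qed

theorem lemma2p2:
  fixes S :: "(real^'n) set"
    and P :: "real^'n \<Rightarrow> real^'m^'k"
    and Q :: "real^'n \<Rightarrow> real^'m2^'k2"
  assumes "S \<in> sets lebesgue" and "emeasure lebesgue S > 0"
    and "matrix_poly P" and "matrix_poly Q"
    and "\<forall>\<xi>\<in>S. rank (P \<xi>) + rank (Q \<xi>) = s"
  shows "(\<exists>r. \<forall>\<xi>\<in>S. rank (P \<xi>) = r) \<and> (\<exists>r. \<forall>\<xi>\<in>S. rank (Q \<xi>) = r)"
proof -
  obtain RP where RP: "\<And>\<xi>. rank (P \<xi>) \<le> RP" "negligible {\<xi>. rank (P \<xi>) < RP}"
    using polynomial_matrix_generic_rank assms(3) poly_fun_imp_real_polynomial_function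
    unfolding matrix_poly_def by metis
  obtain RQ where RQ: "\<And>\<xi>. rank (Q \<xi>) \<le> RQ" "negligible {\<xi>. rank (Q \<xi>) < RQ}"
    using polynomial_matrix_generic_rank assms(4) poly_fun_imp_real_polynomial_function
    unfolding matrix_poly_def by metis
  have "\<not> negligible S"
    using assms(1,2) negligible_iff_emeasure0 by fastforce
  then have "\<not> S \<subseteq> {\<xi>. rank (P \<xi>) < RP} \<union> {\<xi>. rank (Q \<xi>) < RQ}"
    using RP(2) RQ(2) negligible_Un negligible_subset by blast
  then obtain \<xi>1 where "\<xi>1 \<in> S" "\<not> rank (P \<xi>1) < RP" "\<not> rank (Q \<xi>1) < RQ"
    by blast
  then have "s = RP + RQ"
    using assms(5) RP(1)[of \<xi>1] RQ(1)[of \<xi>1] by force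
  then have "rank (P \<xi>) = RP \<and> rank (Q \<xi>) = RQ" if "\<xi> \<in> S" for \<xi>
    using assms(5) that RP(1)[of \<xi>] RQ(1)[of \<xi>] by force
  then show ?thesis
    by blast
qed

end
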